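(* Let $\Phi$ be an $n \times N$ matrix whose column vectors all have Euclidean norm $1$. Let $m, k$ be integers with $2 \le m \le k$, and assume that $\Phi$ satisfies the Restricted Isometry Property of order $m$ with parameter $\epsilon$. Then $\Phi$ also satisfies the Restricted Isometry Property of order $k$ with parameter $\delta = \epsilon (k-1)/(m-1)$.
   Context: A vector $x \in \mathbb{C}^N$ is $k$-sparse if it has at most $k$ nonzero coordinates. An $n\times N$ matrix $\Phi$ satisfies the Restricted Isometry Property (RIP) of order $k$ with parameter $\delta$ if for every $k$-sparse vector $x$, $(1-\delta)\|x\|^2 \le \|\Phi x\|^2 \le (1+\delta)\|x\|^2$. *)

theory Defs
  imports "HOL-Analysis.Analysis"
begin

definition sparse :: "nat \<Rightarrow> complex ^ 'N \<Rightarrow> bool" where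
  "sparse k x \<longleftrightarrow> card {i. x $ i \<noteq> 0} \<le> k"

definition RIP :: "complex ^ 'N ^ 'n \<Rightarrow> nat \<Rightarrow> real \<Rightarrow> bool" where
  "RIP \<Phi> k \<delta> \<longleftrightarrow>
     (\<forall>x. sparse k x \<longrightarrow>
        (1 - \<delta>) * (norm x)\<^sup>2 \<le> (norm (\<Phi> *v x))\<^sup>2 \<and>
        (norm (\<Phi> *v x))\<^sup>2 \<le> (1 + \<delta>) * (norm x)\<^sup>2)"

end

theory Submission
  imports Defs
begin

text \<open>
  It suffices to pass from order \<open>s\<close> to order \<open>s + 1\<close>, since the factors \<open>s / (s - 1)\<close> telescope.
  If the support \<open>S\<close> of \<open>x\<close> has exactly \<open>s + 1\<close> elements, apply the hypothesis to the
  \<open>s + 1\<close> vectors obtained from \<open>x\<close> by deleting one nonzero coordinate, and add up.  Writing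
  \<open>\<Phi> x\<close> as the sum of the \<open>a\<^sub>i = x\<^sub>i \<Phi>\<^sub>i\<close> with \<open>\<parallel>a\<^sub>i\<parallel> = \<bar>x\<^sub>i\<bar>\<close>, expanding the squares gives
  \<open>(s - 1) \<parallel>\<Phi> x\<parallel>\<^sup>2 + \<parallel>x\<parallel>\<^sup>2\<close> for the sum of the squared image norms, while the squared norms of
  the truncated vectors sum to \<open>s \<parallel>x\<parallel>\<^sup>2\<close>.
\<close>

text \<open>The cross terms add up to \<open>-2 * (y \<bullet> y)\<close> because the
  \<open>a i\<close> sum to \<open>y\<close>; no orthogonality among them is assumed. The real inner
  product suffices: on complex vectors it is the real part of the Hermitian one.\<close>

lemma sum_norm_diff_square:
  fixes a :: "'i \<Rightarrow> 'a :: real_inner"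
  assumes "y = (\<Sum>i\<in>S. a i)"
  shows "(\<Sum>i\<in>S. (norm (y - a i))\<^sup>2) = (real (card S) - 2) * (norm y)\<^sup>2 + (\<Sum>i\<in>S. (norm (a i))\<^sup>2)"
proof -
  have "(\<Sum>i\<in>S. (norm (y - a i))\<^sup>2) = (\<Sum>i\<in>S. y \<bullet> y - 2 * (y \<bullet> a i) + a i \<bullet> a i)"
    by (intro sum.cong refl)
       (simp add: power2_norm_eq_inner inner_diff_left inner_diff_right inner_commute)
  also have "\<dots> = real (card S) * (y \<bullet> y) - 2 * (y \<bullet> (\<Sum>i\<in>S. a i)) + (\<Sum>i\<in>S. a i \<bullet> a i)"
    by (simp add: sum.distrib sum_subtractf sum_distrib_left inner_sum_right)
  finally show ?thesis
    using assms by (simp add: power2_norm_eq_inner algebra_simps)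
qed

lemma norm_axis_eq: "norm (axis i c :: 'a::real_normed_vector ^ 'n) = norm c"
proof -
  have "(\<Sum>j\<in>UNIV. (norm ((axis i c :: 'a ^ 'n) $ j))\<^sup>2) = (\<Sum>j\<in>UNIV. if j = i then (norm c)\<^sup>2 else 0)"
    by (intro sum.cong) (auto simp: axis_def)
  then show ?thesis
    by (simp add: norm_vec_def L2_set_def)
qed

lemma norm_vector_scalar_mult:
  fixes v :: "'a::real_normed_field ^ 'n"
  shows "norm (c *s v) = norm c * norm v"
  by (simp add: norm_vec_def norm_mult L2_set_right_distrib)

lemma matrix_vector_mult_axis:
  fixes A :: "'a::comm_ring_1 ^ 'N ^ 'n"
  shows "A *v axis i c = c *s column i A"
proof -
  have "(\<Sum>j\<in>UNIV. A $ r $ j * axis i c $ j) = c * A $ r $ i" for r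
  proof -
    have "(\<Sum>j\<in>UNIV. A $ r $ j * axis i c $ j) = (\<Sum>j\<in>UNIV. if j = i then c * A $ r $ i else 0)"
      by (intro sum.cong) (auto simp: axis_def)
    then show ?thesis by simp
  qed
  then show ?thesis
    by (simp add: vec_eq_iff matrix_vector_mult_def column_def)
qed

lemma sum_axis_support:
  fixes x :: "'a::comm_monoid_add ^ 'N"
  shows "(\<Sum>i | x $ i \<noteq> 0. axis i (x $ i)) = x"
proof (rule vec_eq_iff[THEN iffD2], rule allI)
  fix j
  have "(\<Sum>i | x $ i \<noteq> 0. axis i (x $ i)) $ j = (\<Sum>i | x $ i \<noteq> 0. if i = j then x $ j else 0)"
    unfolding sum_component by (intro sum.cong) (auto simp: axis_def)
  then show "(\<Sum>i | x $ i \<noteq> 0. axis i (x $ i)) $ j = x $ j"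
    by simp
qed

lemma sum_norm_square_support:
  fixes x :: "'a::real_normed_vector ^ 'N"
  shows "(\<Sum>i | x $ i \<noteq> 0. (norm (x $ i))\<^sup>2) = (norm x)\<^sup>2"
proof -
  have "(\<Sum>i | x $ i \<noteq> 0. (norm (x $ i))\<^sup>2) = (\<Sum>i\<in>UNIV. (norm (x $ i))\<^sup>2)"
    by (rule sum.mono_neutral_left) auto
  then show ?thesis
    by (simp add: norm_vec_def L2_set_def sum_nonneg)
qed

text \<open>Here the summands \<open>axis i (x $ i)\<close> have squared norms adding up to that of
  \<open>x\<close> itself, which turns the coefficient \<open>card - 2\<close> into
  \<open>card - 1\<close>.\<close>

lemma sum_norm_delete_coordinate:
  fixes x :: "'a::real_inner ^ 'N"
  shows "(\<Sum>i | x $ i \<noteq> 0. (norm (x - axis i (x $ i)))\<^sup>2)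
    = (real (card {i. x $ i \<noteq> 0}) - 1) * (norm x)\<^sup>2"
  using sum_norm_diff_square[OF sum_axis_support[of x, symmetric]]
  by (simp add: norm_axis_eq sum_norm_square_support algebra_simps)

text \<open>The summands are now multiples of columns. Unit columns make their squared norms add up
  to \<open>(norm x)\<^sup>2\<close>, so the last term does not depend on
  \<open>\<Phi>\<close>.\<close>

lemma sum_norm_image_delete_coordinate:
  fixes \<Phi> :: "complex ^ 'N ^ 'n"
  assumes "\<And>j. norm (column j \<Phi>) = 1"
  shows "(\<Sum>i | x $ i \<noteq> 0. (norm (\<Phi> *v (x - axis i (x $ i))))\<^sup>2)
    = (real (card {i. x $ i \<noteq> 0}) - 2) * (norm (\<Phi> *v x))\<^sup>2 + (norm x)\<^sup>2"
proof -
  have "\<Phi> *v x = \<Phi> *v (\<Sum>i | x $ i \<noteq> 0. axis i (x $ i))"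
    by (simp only: sum_axis_support)
  also have "\<dots> = (\<Sum>i | x $ i \<noteq> 0. \<Phi> *v axis i (x $ i))"
    by (rule linear_sum) (rule matrix_vector_mul_linear)
  finally have "\<Phi> *v x = (\<Sum>i | x $ i \<noteq> 0. \<Phi> *v axis i (x $ i))" .
  from sum_norm_diff_square[OF this] show ?thesis
    by (simp add: matrix_vector_mult_diff_distrib matrix_vector_mult_axis
        norm_vector_scalar_mult assms sum_norm_square_support)
qed

lemma sparse_delete_coordinate:
  assumes "sparse (Suc s) x" and "x $ i \<noteq> 0"
  shows "sparse s (x - axis i (x $ i))"
proof -
  have "{j. (x - axis i (x $ i)) $ j \<noteq> 0} = {j. x $ j \<noteq> 0} - {i}"
    by (auto simp: axis_def)
  then show ?thesis
    using assms by (simp add: sparse_def card_Diff_singleton)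
qed

text \<open>A coordinate vector is mapped to a unit column, so the lower bound reads
  \<open>1 - \<delta> \<le> 1\<close>. The sign is needed to weaken \<open>\<delta>\<close> to a
  larger multiple of itself.\<close>

lemma RIP_nonneg:
  fixes \<Phi> :: "complex ^ 'N ^ 'n"
  assumes "\<And>j. norm (column j \<Phi>) = 1" and "RIP \<Phi> s \<delta>" and "1 \<le> s"
  shows "0 \<le> \<delta>"
proof -
  fix i :: 'N
  have "{j. axis i (1::complex) $ j \<noteq> 0} = {i}"
    by (auto simp: axis_def)
  then have "sparse s (axis i 1)"
    using assms(3) by (simp add: sparse_def)
  then have "(1 - \<delta>) * (norm (axis i (1::complex)))\<^sup>2 \<le> (norm (\<Phi> *v axis i 1))\<^sup>2"
    using assms(2) unfolding RIP_def by blast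
  then show ?thesis
    by (simp add: norm_axis_eq matrix_vector_mult_axis assms(1))
qed

lemma RIP_Suc:
  fixes \<Phi> :: "complex ^ 'N ^ 'n"
  assumes unit: "\<And>j. norm (column j \<Phi>) = 1" and rip: "RIP \<Phi> s \<delta>" and s: "2 \<le> s"
  shows "RIP \<Phi> (Suc s) (\<delta> * real s / (real s - 1))"
  unfolding RIP_def
proof (intro allI impI)
  fix x :: "complex ^ 'N"
  assume x: "sparse (Suc s) x"
  define \<eta> where "\<eta> = \<delta> * real s / (real s - 1)"
  define S where "S = {i. x $ i \<noteq> 0}"
  have \<delta>: "0 \<le> \<delta>"
    using RIP_nonneg[OF unit rip] s by simp
  have bounds: "(1 - \<delta>) * (norm z)\<^sup>2 \<le> (norm (\<Phi> *v z))\<^sup>2"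
    "(norm (\<Phi> *v z))\<^sup>2 \<le> (1 + \<delta>) * (norm z)\<^sup>2" if "sparse s z" for z
    using rip that unfolding RIP_def by blast+
  have "(1 - \<eta>) * (norm x)\<^sup>2 \<le> (norm (\<Phi> *v x))\<^sup>2 \<and> (norm (\<Phi> *v x))\<^sup>2 \<le> (1 + \<eta>) * (norm x)\<^sup>2"
  proof (cases "card S = Suc s")
    case False
    then have sp: "sparse s x"
      using x by (simp add: sparse_def S_def)
    \<comment> \<open>The bounds for \<open>\<delta>\<close> already apply to \<open>x\<close>; they
      only have to be relaxed, using \<open>0 \<le> \<delta>\<close> and
      \<open>s / (s - 1) \<ge> 1\<close>.\<close>
    have "\<delta> \<le> \<eta>"
      using \<delta> s by (simp add: \<eta>_def field_simps)
    then have "(1 - \<eta>) * (norm x)\<^sup>2 \<le> (1 - \<delta>) * (norm x)\<^sup>2"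
      "(1 + \<delta>) * (norm x)\<^sup>2 \<le> (1 + \<eta>) * (norm x)\<^sup>2"
      by (intro mult_right_mono; simp)+
    with bounds[OF sp] show ?thesis by linarith
  next
    case True
    have sp: "sparse s (x - axis i (x $ i))" if "i \<in> S" for i
      using sparse_delete_coordinate[OF x] that by (simp add: S_def)
    have norms: "(\<Sum>i\<in>S. (norm (x - axis i (x $ i)))\<^sup>2) = real s * (norm x)\<^sup>2"
      using sum_norm_delete_coordinate[of x] True by (simp add: S_def)
    have images: "(\<Sum>i\<in>S. (norm (\<Phi> *v (x - axis i (x $ i))))\<^sup>2)
        = (real s - 1) * (norm (\<Phi> *v x))\<^sup>2 + (norm x)\<^sup>2"
      using sum_norm_image_delete_coordinate[OF unit, of x] True by (simp add: S_def)
    have "(1 - \<delta>) * (real s * (norm x)\<^sup>2) \<le> (real s - 1) * (norm (\<Phi> *v x))\<^sup>2 + (norm x)\<^sup>2"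
      unfolding norms[symmetric] images[symmetric] sum_distrib_left
      by (intro sum_mono bounds sp)
    moreover have "(real s - 1) * (norm (\<Phi> *v x))\<^sup>2 + (norm x)\<^sup>2 \<le> (1 + \<delta>) * (real s * (norm x)\<^sup>2)"
      unfolding norms[symmetric] images[symmetric] sum_distrib_left
      by (intro sum_mono bounds sp)
    \<comment> \<open>This is where the value of \<open>\<eta>\<close> comes from: moving
      \<open>(norm x)\<^sup>2\<close> across leaves the factors
      \<open>(1 - \<delta>) * s - 1\<close> and \<open>(1 + \<delta>) * s - 1\<close>, which equal
      \<open>(s - 1) * (1 - \<eta>)\<close> and \<open>(s - 1) * (1 + \<eta>)\<close>.\<close>
    moreover have "(real s - 1) * \<eta> = \<delta> * real s"
      using s by (simp add: \<eta>_def)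
    then have "(real s - 1) * ((1 - \<eta>) * (norm x)\<^sup>2) = (1 - \<delta>) * (real s * (norm x)\<^sup>2) - (norm x)\<^sup>2"
      "(real s - 1) * ((1 + \<eta>) * (norm x)\<^sup>2) = (1 + \<delta>) * (real s * (norm x)\<^sup>2) - (norm x)\<^sup>2"
      by algebra+
    ultimately have "(real s - 1) * ((1 - \<eta>) * (norm x)\<^sup>2) \<le> (real s - 1) * (norm (\<Phi> *v x))\<^sup>2"
      "(real s - 1) * (norm (\<Phi> *v x))\<^sup>2 \<le> (real s - 1) * ((1 + \<eta>) * (norm x)\<^sup>2)"
      by linarith+
    then show ?thesis
      using s by (simp add: mult_le_cancel_left_pos)
  qed
  then show "(1 - \<delta> * real s / (real s - 1)) * (norm x)\<^sup>2 \<le> (norm (\<Phi> *v x))\<^sup>2 \<and>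
      (norm (\<Phi> *v x))\<^sup>2 \<le> (1 + \<delta> * real s / (real s - 1)) * (norm x)\<^sup>2"
    by (simp only: \<eta>_def)
qed

theorem theorem1:
  fixes \<Phi> :: "complex ^ 'N ^ 'n" and m k :: nat and \<epsilon> :: real
  assumes "\<And>j. norm (column j \<Phi>) = 1"
    and "2 \<le> m" and "m \<le> k"
    and "RIP \<Phi> m \<epsilon>"
  shows "RIP \<Phi> k (\<epsilon> * (real k - 1) / (real m - 1))"
  using \<open>m \<le> k\<close>
proof (induction k rule: dec_induct)
  case base
  then show ?case
    using assms(2,4) by simp
next
  case (step s)
  have "RIP \<Phi> (Suc s) (\<epsilon> * (real s - 1) / (real m - 1) * real s / (real s - 1))"
    using RIP_Suc[OF assms(1) step.IH] step.hyps assms(2) by simp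
  \<comment> \<open>The factor \<open>s - 1\<close> cancels, being nonzero by
    \<open>2 \<le> m \<le> s\<close>, and the remaining \<open>s\<close> is
    \<open>Suc s - 1\<close>.\<close>
  moreover have "\<epsilon> * (real s - 1) / (real m - 1) * real s / (real s - 1)
      = \<epsilon> * (real (Suc s) - 1) / (real m - 1)"
    using step.hyps assms(2) by simp
  ultimately show ?case
    by simp
qed

end
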